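(* Let $k$ and $s$ be integers with $k \geq 2$ and $s \geq 2$. The limit \[ \lim_{n\rightarrow \infty} \frac{g_k^{(s)}(n)}{n} = (s-1) \sum_{m=1}^{\infty} \left( \frac{1}{s} \right)^{\min \left( r_k^{-1}(m)\right)} \] exists and converges to an irrational number.
   Context: $\mathbf{N}$ denotes the set of positive integers. For $\ell \in \mathbf{N}$, $r_k(\ell)$ denotes the cardinality of the largest subset of $\{0,1,2,\ldots,\ell-1\}$ that contains no arithmetic progression of length $k$ (a set $\{v+dj : j=0,1,\ldots,k-1\}$ with $d \geq 1$). For $m \in \mathbf{N}$, $r_k^{-1}(m) = \{\ell \in \mathbf{N} : r_k(\ell) = m\}$, and $\min(r_k^{-1}(m))$ is its least element. For $n \in \mathbf{N}$, $g_k^{(s)}(n)$ denotes the cardinality of the largest subset of $\{1,2,\ldots,n\}$ that contains no geometric progression of length $k$ whose common ratio is a power of $s$, i.e. no set of the form $\{a (s^d)^j : j = 0,1,\ldots,k-1\}$ with $a, d \in \mathbf{N}$.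
   Formalization: Irrationality is claimed only for k ≥ 3, since for k = 2 the limit is (s-1)/s, which is rational; the limit formula is kept for all k ≥ 2, with the term for m read as 0 when r_k^{-1}(m) is empty (only for k = 2, m ≥ 2). *)

theory Defs
  imports Complex_Main
begin

definition arith_prog :: "nat \<Rightarrow> nat \<Rightarrow> nat \<Rightarrow> nat set" where
  "arith_prog k v d = {v + d * j | j. j < k}"

definition ap_free :: "nat \<Rightarrow> nat set \<Rightarrow> bool" where
  "ap_free k A \<longleftrightarrow> \<not> (\<exists>v d. d \<ge> 1 \<and> arith_prog k v d \<subseteq> A)"

definition r_max :: "nat \<Rightarrow> nat \<Rightarrow> nat" where
  "r_max k l = Max (card ` {A. A \<subseteq> {0..<l} \<and> ap_free k A})"

definition r_inv :: "nat \<Rightarrow> nat \<Rightarrow> nat set" where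
  "r_inv k m = {l. l \<ge> 1 \<and> r_max k l = m}"

definition geom_prog :: "nat \<Rightarrow> nat \<Rightarrow> nat \<Rightarrow> nat \<Rightarrow> nat set" where
  "geom_prog k s a d = {a * (s ^ d) ^ j | j. j < k}"

definition gp_free :: "nat \<Rightarrow> nat \<Rightarrow> nat set \<Rightarrow> bool" where
  "gp_free k s A \<longleftrightarrow> \<not> (\<exists>a d. a \<ge> 1 \<and> d \<ge> 1 \<and> geom_prog k s a d \<subseteq> A)"

definition g_max :: "nat \<Rightarrow> nat \<Rightarrow> nat \<Rightarrow> nat" where
  "g_max k s n = Max (card ` {A. A \<subseteq> {1..n} \<and> gp_free k s A})"

(* min {} is read as infinity, so that an m outside the range of r_max k contributes 0.
   This happens only for k = 2, where r_max k is constantly 1 on the positive integers. *)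
definition min_fiber_term :: "nat \<Rightarrow> nat \<Rightarrow> nat \<Rightarrow> real" where
  "min_fiber_term k s m =
     (if r_inv k m = {} then 0 else (1 / real s) ^ (LEAST l. l \<in> r_inv k m))"

end

theory Submission
  imports Defs "HOL-Analysis.Infinite_Sum" "HOL-Analysis.Uniform_Limit"
begin

text \<open>
  Every positive integer is uniquely \<open>u * s ^ i\<close> with \<open>s\<close> not dividing \<open>u\<close>, and geometric
  progressions with ratio a power of \<open>s\<close> are arithmetic progressions of exponents inside one
  such chain. Counting chains by length gives
  \<open>g n = (\<Sum>i. e i * (n div s ^ i - n div s ^ Suc i))\<close>, where \<open>e i = r (i + 1) - r i\<close> is \<open>0\<close> or
  \<open>1\<close>; Tannery's theorem yields the density \<open>(s - 1) * (\<Sum>i. e i / s ^ (i + 1))\<close>, and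
  the nonzero digits \<open>e i\<close> sit exactly at the minima of the fibres of \<open>r\<close>.

  If this number were rational, the digits \<open>e\<close> would be eventually periodic, so \<open>r l\<close> would
  stay within a bounded distance of \<open>\<alpha> * l\<close> for some \<open>\<alpha> > 0\<close>. Then an extremal
  progression-free set has no long gaps, since the two pieces on either side of a gap would
  have to be larger than \<open>r\<close> allows. Van der Waerden's theorem, with the distance to the next
  element as colour, produces a progression in any such set. Szemeredi's theorem is not needed.
\<close>

subsection \<open>Van der Waerden's theorem\<close>

text \<open>One \<open>M\<close> serves all colourings and bounds both start and difference, so the
  progression lies in a window of fixed size. The induction on \<open>k\<close> needs this to cut
  the integers into blocks.\<close>

definition van_der_waerden_bound :: "nat \<Rightarrow> nat \<Rightarrow> nat \<Rightarrow> bool" where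
  "van_der_waerden_bound k r M \<longleftrightarrow>
     (\<forall>f::nat \<Rightarrow> nat. (\<forall>x. f x < r) \<longrightarrow>
        (\<exists>a d. a < M \<and> 1 \<le> d \<and> d \<le> M \<and> (\<forall>j<k. f (a + d * j) = f a)))"

text \<open>The classical focusing condition: one progression of length \<open>k\<close> in each
  colour of \<open>C\<close>, all with the same would-be next term \<open>z\<close>. If
  \<open>z\<close> has a colour in \<open>C\<close>, one of them grows to length
  \<open>Suc k\<close>.\<close>

definition colour_focused :: "nat \<Rightarrow> nat \<Rightarrow> (nat \<Rightarrow> nat) \<Rightarrow> nat \<Rightarrow> nat set \<Rightarrow> bool" where
  "colour_focused k M f z C \<longleftrightarrow> z < M \<and>
     (\<forall>c\<in>C. \<exists>a d. 1 \<le> d \<and> d \<le> M \<and> a + d * k = z \<and> (\<forall>j<k. f (a + d * j) = c))"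

text \<open>Allows colour vectors of whole blocks to serve as colours: a finite colour set is
  numbered injectively.\<close>

lemma van_der_waerden_finite_colours:
  fixes S :: "'c set"
  assumes bound: "\<And>r. \<exists>M. van_der_waerden_bound k r M" and fin: "finite S"
  shows "\<exists>M. \<forall>F::nat \<Rightarrow> 'c. (\<forall>x. F x \<in> S) \<longrightarrow>
      (\<exists>a d. a < M \<and> 1 \<le> d \<and> d \<le> M \<and> (\<forall>j<k. F (a + d * j) = F a))"
proof -
  obtain h :: "'c \<Rightarrow> nat" and r where h: "h ` S = {i. i < r}" "inj_on h S"
    using finite_imp_inj_to_nat_seg[OF fin] by blast
  obtain M where M: "van_der_waerden_bound k r M"
    using bound by blast
  have "\<exists>a d. a < M \<and> 1 \<le> d \<and> d \<le> M \<and> (\<forall>j<k. F (a + d * j) = F a)"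
    if F: "\<forall>x. F x \<in> S" for F :: "nat \<Rightarrow> 'c"
  proof -
    have "\<forall>x. h (F x) < r"
      using F h(1) by blast
    then obtain a d where "a < M" "1 \<le> d" "d \<le> M" "\<forall>j<k. h (F (a + d * j)) = h (F a)"
      using M unfolding van_der_waerden_bound_def by meson
    moreover have "F x = F y" if "h (F x) = h (F y)" for x y
      using that F h(2) by (auto dest: inj_onD)
    ultimately show ?thesis
      by blast
  qed
  then show ?thesis
    by blast
qed

text \<open>Induction on the number \<open>t\<close> of focused colours. Blocks of length
  \<open>M\<close> are coloured by their colour vectors, and the case of length \<open>k\<close>
  gives \<open>k\<close> equally spaced blocks with identical patterns. The focused family inside
  one block is then spread across these blocks, and the copies of its focus supply a further
  colour.\<close>

lemma colour_focusing:
  assumes bound: "\<And>r. \<exists>M. van_der_waerden_bound k r M" and "t \<le> r"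
  shows "\<exists>M. \<forall>f::nat \<Rightarrow> nat. (\<forall>x. f x < r) \<longrightarrow>
      (\<exists>a d. a < M \<and> 1 \<le> d \<and> d \<le> M \<and> (\<forall>j<Suc k. f (a + d * j) = f a)) \<or>
      (\<exists>z C. C \<subseteq> {..<r} \<and> card C = t \<and> colour_focused k M f z C)"
  using \<open>t \<le> r\<close>
proof (induction t)
  case 0
  have "colour_focused k 1 f 0 {}" for f
    by (simp add: colour_focused_def)
  then show ?case
    by (intro exI[of _ 1] allI impI disjI2 exI[of _ 0] exI[of _ "{}"]) simp
next
  case (Suc t)
  obtain M where "\<forall>f. (\<forall>x. f x < r) \<longrightarrow>
      (\<exists>a d. a < M \<and> 1 \<le> d \<and> d \<le> M \<and> (\<forall>j<Suc k. f (a + d * j) = f a)) \<or>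
      (\<exists>z C. C \<subseteq> {..<r} \<and> card C = t \<and> colour_focused k M f z C)"
    using Suc.IH[OF Suc_leD[OF Suc.prems]] ..
  note M = this[rule_format]
  define S where "S = {xs. set xs \<subseteq> {..<r} \<and> length xs = M}"
  have "finite S"
    unfolding S_def by (rule finite_lists_length_eq) simp
  obtain M' where "\<forall>F. (\<forall>x. F x \<in> S) \<longrightarrow>
      (\<exists>a d. a < M' \<and> 1 \<le> d \<and> d \<le> M' \<and> (\<forall>j<k. F (a + d * j) = F a))"
    using van_der_waerden_finite_colours[OF bound \<open>finite S\<close>] ..
  note M' = this[rule_format]
  \<comment> \<open>Large enough for every start and difference below, and for the new focus
    \<open>(v + d * k) * M + z\<close> with \<open>v < M'\<close>, \<open>d \<le> M'\<close> and
    \<open>z < M\<close>.\<close>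
  define N where "N = M * (M' * (k + 2) + 2)"
  have "(\<exists>a d. a < N \<and> 1 \<le> d \<and> d \<le> N \<and> (\<forall>j<Suc k. f (a + d * j) = f a)) \<or>
      (\<exists>z C. C \<subseteq> {..<r} \<and> card C = Suc t \<and> colour_focused k N f z C)"
    (is "?mono \<or> ?focused") if f: "\<forall>x. f x < r" for f
  proof -
    define F where "F y = map (\<lambda>i. f (y * M + i)) [0..<M]" for y
    have "\<forall>y. F y \<in> S"
      using f by (auto simp: S_def F_def)
    then obtain v d where v: "v < M'" and d: "1 \<le> d" "d \<le> M'"
      and Feq: "\<forall>j<k. F (v + d * j) = F v"
      using M' by blast
    have block: "f ((v + d * j) * M + i) = f (v * M + i)" if "j < k" "i < M" for j i
    proof -
      have "F (v + d * j) ! i = F v ! i"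
        using Feq that by simp
      then show ?thesis
        using that by (simp add: F_def)
    qed
    have vM: "v * M + x < N" if "x < M" for x
    proof -
      have "v * M + x < (v + 1) * M"
        using that by simp
      also have "\<dots> \<le> (M' * (k + 2) + 2) * M"
        using v by (intro mult_right_mono) auto
      finally show ?thesis
        by (simp add: N_def mult.commute)
    qed
    have dM: "x + d * M \<le> N" if "x \<le> M" for x
    proof -
      have "x + d * M \<le> (1 + d) * M"
        using that by simp
      also have "\<dots> \<le> (M' * (k + 2) + 2) * M"
        using d by (intro mult_right_mono) auto
      finally show ?thesis
        by (simp add: N_def mult.commute)
    qed
    from M[of "\<lambda>x. f (v * M + x)"] f
    consider (mono) a e where "a < M" "1 \<le> e" "e \<le> M"
        "\<forall>j<Suc k. f (v * M + (a + e * j)) = f (v * M + a)"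
      | (focused) z C where "C \<subseteq> {..<r}" "card C = t"
        "colour_focused k M (\<lambda>x. f (v * M + x)) z C"
      by blast
    then show ?thesis
    proof cases
      case mono
      then have "v * M + a < N" "e \<le> N" "\<forall>j<Suc k. f ((v * M + a) + e * j) = f (v * M + a)"
        using vM[of a] dM[of e] by (auto simp: add.assoc)
      then show ?thesis
        using \<open>1 \<le> e\<close> by blast
    next
      case focused
      define c where "c = f (v * M + z)"
      have z: "z < M" and foc: "\<And>b. b \<in> C \<Longrightarrow> \<exists>a e. 1 \<le> e \<and> e \<le> M \<and> a + e * k = z \<and>
          (\<forall>j<k. f (v * M + (a + e * j)) = b)"
        using focused(3) by (auto simp: colour_focused_def)
      show ?thesis
      proof (cases "c \<in> C")
        case True
        \<comment> \<open>The colour of the focus is already represented, so its progression extends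
          by \<open>z\<close> to length \<open>Suc k\<close>.\<close>
        then obtain a e where ae: "1 \<le> e" "e \<le> M" "a + e * k = z"
            "\<forall>j<k. f (v * M + (a + e * j)) = c"
          using foc by blast
        have eq: "f ((v * M + a) + e * j) = c" if "j < Suc k" for j
        proof (cases "j = k")
          case True
          then show ?thesis
            using ae(3) by (simp add: c_def add.assoc)
        next
          case False
          then show ?thesis
            using ae(4) that by (simp add: add.assoc)
        qed
        have "\<forall>j<Suc k. f ((v * M + a) + e * j) = f (v * M + a)"
          using eq eq[of 0] by simp
        moreover have "v * M + a < N" "e \<le> N"
          using vM[of a] dM[of e] ae z by auto
        ultimately show ?thesis
          using ae(1) by blast
      next
        case False
        \<comment> \<open>The copy of \<open>z\<close> in the block following the \<open>k\<close>
          equal ones. Adding \<open>d * M\<close> to each old difference moves one block further per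
          term, so the old progressions now focus on \<open>z'\<close>. The copies of
          \<open>z\<close> itself form the progression for the new colour \<open>c\<close>.\<close>
        define z' where "z' = (v + d * k) * M + z"
        have "z' < (v + d * k + 1) * M"
          using z by (simp add: z'_def)
        also have "v + d * k + 1 \<le> M' * (k + 2) + 2"
          using v mult_le_mono1[OF d(2), of k] unfolding add_mult_distrib2 by linarith
        finally have z': "z' < N"
          by (simp add: N_def mult.commute)
        have "\<exists>a e. 1 \<le> e \<and> e \<le> N \<and> a + e * k = z' \<and> (\<forall>j<k. f (a + e * j) = b)"
          if b: "b \<in> insert c C" for b
        proof (cases "b = c")
          case True
          have "f ((v * M + z) + (d * M) * j) = b" if "j < k" for j
            using block[OF that z] True by (simp add: c_def algebra_simps)
          moreover have "(v * M + z) + (d * M) * k = z'"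
            by (simp add: z'_def algebra_simps)
          moreover have "1 \<le> d * M" "d * M \<le> N"
            using d z dM[of 0] by auto
          ultimately show ?thesis
            by blast
        next
          case False
          then obtain a e where ae: "1 \<le> e" "e \<le> M" "a + e * k = z"
            "\<forall>j<k. f (v * M + (a + e * j)) = b"
            using foc b by blast
          have "f ((v * M + a) + (e + d * M) * j) = b" if j: "j < k" for j
          proof -
            have "a + e * j \<le> a + e * k"
              using j by simp
            then have "a + e * j < M"
              using ae(3) z by linarith
            have "f ((v * M + a) + (e + d * M) * j) = f ((v + d * j) * M + (a + e * j))"
              by (simp add: algebra_simps)
            also have "\<dots> = b"
              using block[OF j \<open>a + e * j < M\<close>] ae(4) j by simp
            finally show ?thesis .
          qed
          moreover have "(v * M + a) + (e + d * M) * k = z'"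
            unfolding z'_def ae(3)[symmetric] by (simp add: algebra_simps)
          moreover have "1 \<le> e + d * M" "e + d * M \<le> N"
            using ae dM[of e] by auto
          ultimately show ?thesis
            by blast
        qed
        then have "colour_focused k N f z' (insert c C)"
          using z' by (auto simp: colour_focused_def)
        moreover have "card (insert c C) = Suc t"
          using False focused(1,2) by (simp add: finite_subset)
        moreover have "insert c C \<subseteq> {..<r}"
          using focused(1) f by (simp add: c_def)
        ultimately show ?thesis
          by blast
      qed
    qed
  qed
  then show ?case
    by blast
qed

text \<open>With all \<open>r\<close> colours focused at one point, the colour of that point must be
  among them, which completes a progression of length \<open>Suc k\<close>.\<close>

theorem van_der_waerden: "\<exists>M. van_der_waerden_bound k r M"
proof (induction k arbitrary: r)
  case 0
  have "van_der_waerden_bound 0 r 1"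
    by (auto simp: van_der_waerden_bound_def)
  then show ?case
    by blast
next
  case (Suc k)
  then obtain M where M: "\<And>f::nat \<Rightarrow> nat. (\<forall>x. f x < r) \<Longrightarrow>
      (\<exists>a d. a < M \<and> 1 \<le> d \<and> d \<le> M \<and> (\<forall>j<Suc k. f (a + d * j) = f a)) \<or>
      (\<exists>z C. C \<subseteq> {..<r} \<and> card C = r \<and> colour_focused k M f z C)"
    using colour_focusing[of k r r] by blast
  have "\<exists>a d. a < M \<and> 1 \<le> d \<and> d \<le> M \<and> (\<forall>j<Suc k. f (a + d * j) = f a)"
    if f: "\<forall>x. f x < r" for f
    using M[OF f]
  proof
    assume "\<exists>z C. C \<subseteq> {..<r} \<and> card C = r \<and> colour_focused k M f z C"
    then obtain z C where C: "C \<subseteq> {..<r}" "card C = r" "colour_focused k M f z C"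
      by blast
    then have "C = {..<r}"
      by (intro card_subset_eq) auto
    then have "f z \<in> C"
      using f by simp
    then obtain a d where ad: "1 \<le> d" "d \<le> M" "a + d * k = z" "\<forall>j<k. f (a + d * j) = f z"
      using C(3) unfolding colour_focused_def by blast
    then have eq: "f (a + d * j) = f z" if "j < Suc k" for j
      using that less_Suc_eq by auto
    moreover have "a < M"
      using ad(3) C(3) by (auto simp: colour_focused_def)
    ultimately show ?thesis
      using ad(1,2) eq[of 0] by (metis add_0_right mult_0_right zero_less_Suc)
  qed
  then show ?case
    unfolding van_der_waerden_bound_def by blast
qed

text \<open>Positions are coloured by an offset leading into \<open>A\<close>; a progression of
  positions with constant offset translates into \<open>A\<close>.\<close>

corollary van_der_waerden_syndetic:
  assumes "w \<ge> 1"
  shows "\<exists>L. \<forall>A. (\<forall>x<L. \<exists>i<w. x + i \<in> A) \<longrightarrow> \<not> ap_free k A"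
proof -
  obtain M where M: "van_der_waerden_bound k w M"
    using van_der_waerden by blast
  have "\<not> ap_free k A" if A: "\<forall>x<M + M * k. \<exists>i<w. x + i \<in> A" for A
  proof -
    \<comment> \<open>The window contains every \<open>a + d * j\<close> with \<open>a < M\<close>,
      \<open>d \<le> M\<close>, \<open>j < k\<close>. Outside it the colour is \<open>0\<close>,
      which is legal because \<open>w \<ge> 1\<close>.\<close>
    define f where "f x = (if x < M + M * k then SOME i. i < w \<and> x + i \<in> A else 0)" for x
    have f: "f x < w \<and> x + f x \<in> A" if "x < M + M * k" for x
      using someI_ex[of "\<lambda>i. i < w \<and> x + i \<in> A"] A that by (auto simp: f_def)
    have "\<forall>x. f x < w"
      using f assms by (metis f_def less_eq_Suc_le One_nat_def)
    then obtain a d where ad: "a < M" "1 \<le> d" "d \<le> M" "\<forall>j<k. f (a + d * j) = f a"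
      using M unfolding van_der_waerden_bound_def by blast
    have "(a + f a) + d * j \<in> A" if j: "j < k" for j
    proof -
      have "d * j \<le> M * k"
        using ad(3) j by (intro mult_mono) auto
      then have "a + d * j < M + M * k"
        using ad(1) by linarith
      then have "a + d * j + f (a + d * j) \<in> A"
        using f by blast
      then show ?thesis
        using ad(4) j by (simp add: ac_simps)
    qed
    then have "arith_prog k (a + f a) d \<subseteq> A"
      by (auto simp: arith_prog_def)
    then show ?thesis
      using ad(2) by (auto simp: ap_free_def)
  qed
  then show ?thesis
    by blast
qed

subsection \<open>The function \<open>r_max\<close>\<close>

lemma ap_free_mono: "ap_free k A \<Longrightarrow> B \<subseteq> A \<Longrightarrow> ap_free k B"
  unfolding ap_free_def by blast

lemma ap_free_empty: "k \<ge> 1 \<Longrightarrow> ap_free k {}"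
  unfolding ap_free_def arith_prog_def by force

lemma finite_ap_free: "finite {A. A \<subseteq> {0..<l} \<and> ap_free k A}"
  by (rule finite_subset[of _ "Pow {0..<l}"]) auto

lemma card_le_r_max: "A \<subseteq> {0..<l} \<Longrightarrow> ap_free k A \<Longrightarrow> card A \<le> r_max k l"
  unfolding r_max_def by (rule Max_ge) (auto simp: finite_ap_free)

lemma r_max_attained:
  assumes "k \<ge> 1"
  obtains A where "A \<subseteq> {0..<l}" "ap_free k A" "card A = r_max k l"
proof -
  have "r_max k l \<in> card ` {A. A \<subseteq> {0..<l} \<and> ap_free k A}"
    unfolding r_max_def using finite_ap_free ap_free_empty[OF assms]
    by (intro Max_in) (auto simp: finite_ap_free)
  then show ?thesis
    using that by auto
qed

text \<open>Being free of progressions is invariant under translation.\<close>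

lemma card_window_le_r_max:
  assumes "ap_free k A"
  shows "card (A \<inter> {u..<u + t}) \<le> r_max k t"
proof -
  define B where "B = {i. i < t \<and> u + i \<in> A}"
  have "A \<inter> {u..<u + t} = (+) u ` B"
    by (force simp: B_def image_iff le_iff_add)
  then have "card (A \<inter> {u..<u + t}) = card B"
    by (simp add: card_image)
  also have "\<dots> \<le> r_max k t"
  proof (rule card_le_r_max)
    show "ap_free k B"
      unfolding ap_free_def
    proof safe
      fix v d :: nat
      assume d: "d \<ge> 1" and B: "arith_prog k v d \<subseteq> B"
      have "arith_prog k (u + v) d \<subseteq> A"
        using B by (fastforce simp: arith_prog_def B_def add.assoc)
      then show False
        using assms d by (auto simp: ap_free_def)
    qed
  qed (auto simp: B_def)
  finally show ?thesis .
qed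

lemma r_max_0: "k \<ge> 1 \<Longrightarrow> r_max k 0 = 0"
  by (metis r_max_attained atLeastLessThan_empty card.empty le_refl subset_empty)

lemma r_max_mono:
  assumes "k \<ge> 1" "l \<le> m"
  shows "r_max k l \<le> r_max k m"
proof -
  obtain A where A: "A \<subseteq> {0..<l}" "ap_free k A" "card A = r_max k l"
    using r_max_attained assms(1) by blast
  moreover have "A \<subseteq> {0..<m}"
    using A(1) assms(2) by auto
  ultimately show ?thesis
    by (metis card_le_r_max)
qed

lemma r_max_Suc_le:
  assumes "k \<ge> 1"
  shows "r_max k (Suc l) \<le> Suc (r_max k l)"
proof -
  obtain A where A: "A \<subseteq> {0..<Suc l}" "ap_free k A" "card A = r_max k (Suc l)"
    using r_max_attained assms by blast
  have "finite A"
    using A(1) finite_subset by blast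
  have "card (A - {l}) \<le> r_max k l"
    using A by (intro card_le_r_max) (auto intro: ap_free_mono simp: less_Suc_eq)
  moreover have "card A \<le> Suc (card (A - {l}))"
    using \<open>finite A\<close> by (simp add: card_Diff_singleton_if) linarith
  ultimately show ?thesis
    using A(3) by linarith
qed

text \<open>Twice the middle term of a three-term progression exceeds the third term by
  \<open>v > 0\<close>, yet a larger power of two is at least the double. These sets make
  \<open>r_max k\<close> unbounded.\<close>

lemma ap_free_powers_of_two:
  assumes "k \<ge> 3"
  shows "ap_free k (range (\<lambda>i. 2 ^ i))"
  unfolding ap_free_def
proof safe
  fix v d :: nat
  assume d: "d \<ge> 1" and sub: "arith_prog k v d \<subseteq> range (\<lambda>i. 2 ^ i)"
  have mem: "v + d * j \<in> range (\<lambda>i. 2 ^ i)" if "j < 3" for j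
    using sub assms that by (force simp: arith_prog_def)
  obtain a b c where abc: "v = 2 ^ a" "v + d = 2 ^ b" "v + d * 2 = 2 ^ c"
    using mem[of 0] mem[of 1] mem[of 2] by auto
  have "(2::nat) ^ b < 2 ^ c"
    using abc d by linarith
  then have "b < c"
    by simp
  then have "(2::nat) ^ Suc b \<le> 2 ^ c"
    by (intro power_increasing) auto
  moreover have "(2::nat) ^ a > 0"
    by simp
  ultimately show False
    using abc by simp
qed

lemma r_max_unbounded:
  assumes "k \<ge> 3"
  shows "m \<le> r_max k (2 ^ m)"
proof -
  have "card ((\<lambda>i. 2 ^ i) ` {..<m} :: nat set) \<le> r_max k (2 ^ m)"
    using ap_free_powers_of_two[OF assms]
    by (intro card_le_r_max) (auto intro: ap_free_mono)
  then show ?thesis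
    by (simp add: card_image inj_on_def)
qed

text \<open>The recursion gives \<open>r_max k\<close> slope \<open>c / p\<close> up to a bounded
  error. A gap of length \<open>w\<close> in an extremal set would cost about
  \<open>c * w / p\<close> elements, more than that error once \<open>w\<close> is large. All
  inequalities are multiplied by \<open>p\<close> to stay in the natural numbers.\<close>

lemma r_max_not_eventually_periodic:
  assumes k: "k \<ge> 1" and c: "c \<ge> 1" and p: "p \<ge> 1"
    and per: "\<And>l. l \<ge> n \<Longrightarrow> r_max k (l + p) = r_max k l + c"
  shows False
proof -
  have mult: "r_max k (n + p * j) = r_max k n + c * j" for j
  proof (induction j)
    case (Suc j)
    then show ?case
      using per[of "n + p * j"] by (simp add: algebra_simps)
  qed simp
  \<comment> \<open>The extra \<open>c\<close> pays for rounding \<open>l\<close> up to the next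
    point of the form \<open>n + p * j\<close>.\<close>
  define D where "D = r_max k n + c"
  have upper: "p * r_max k l \<le> p * D + c * l" for l
  proof (cases "l \<le> n")
    case True
    then have "r_max k l \<le> D"
      using r_max_mono[OF k] by (simp add: D_def trans_le_add1)
    then show ?thesis
      using mult_le_mono2 trans_le_add1 by blast
  next
    case False
    define j where "j = (l - n) div p"
    have j: "p * j \<le> l - n"
      by (simp add: j_def)
    have "l - n < p * Suc j"
      using p dividend_less_div_times[of p "l - n"] by (simp add: j_def algebra_simps)
    then have "l \<le> n + p * Suc j"
      by linarith
    then have "r_max k l \<le> r_max k n + c * Suc j"
      using r_max_mono[OF k] mult by metis
    then have "p * r_max k l \<le> p * (D + c * j)"
      by (simp add: D_def)
    also have "\<dots> = p * D + c * (p * j)"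
      by (simp add: algebra_simps)
    also have "\<dots> \<le> p * D + c * l"
      using j by (intro add_left_mono mult_left_mono) auto
    finally show ?thesis .
  qed
  \<comment> \<open>Exceeds the total error \<open>2 * (p * D) + c * n\<close>: two pieces with
    error \<open>p * D\<close> each, and the offset \<open>n\<close> in the exact value at
    \<open>N\<close>.\<close>
  define w where "w = 2 * (p * D) + c * n + 1"
  have "w \<ge> 1"
    by (simp add: w_def)
  then obtain L where L: "\<And>A. (\<forall>x<L. \<exists>i<w. x + i \<in> A) \<Longrightarrow> \<not> ap_free k A"
    using van_der_waerden_syndetic by blast
  \<comment> \<open>Congruent to \<open>n\<close> modulo \<open>p\<close>, so that
    \<open>r_max k N\<close> is known exactly, and long enough that a gap starting below
    \<open>L\<close> ends within \<open>N\<close>.\<close>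
  define N where "N = n + p * (L + w)"
  have N: "L + w \<le> N"
    using p by (simp add: N_def trans_le_add2)
  obtain A where A: "A \<subseteq> {0..<N}" "ap_free k A" "card A = r_max k N"
    using r_max_attained[OF k] by blast
  have "\<exists>i<w. x + i \<in> A" if x: "x < L" for x
  proof (rule ccontr)
    assume gap: "\<not> ?thesis"
    define y where "y = N - (x + w)"
    have Ny: "N = x + w + y"
      using N x by (simp add: y_def)
    have "A \<subseteq> (A \<inter> {0..<0 + x}) \<union> (A \<inter> {x + w..<x + w + y})"
    proof
      fix a
      assume a: "a \<in> A"
      have "\<not> (x \<le> a \<and> a < x + w)"
      proof
        assume "x \<le> a \<and> a < x + w"
        then have "a - x < w" "x + (a - x) = a"
          by auto
        then show False
          using gap a by metis
      qed
      then show "a \<in> (A \<inter> {0..<0 + x}) \<union> (A \<inter> {x + w..<x + w + y})"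
        using a A(1) Ny by auto
    qed
    then have "card A \<le> card ((A \<inter> {0..<0 + x}) \<union> (A \<inter> {x + w..<x + w + y}))"
      by (intro card_mono) auto
    also have "\<dots> \<le> card (A \<inter> {0..<0 + x}) + card (A \<inter> {x + w..<x + w + y})"
      by (rule card_Un_le)
    also have "\<dots> \<le> r_max k x + r_max k y"
      using card_window_le_r_max[OF A(2)] by (intro add_mono)
    finally have "p * r_max k N \<le> p * r_max k x + p * r_max k y"
      using A(3) by (metis add_mult_distrib2 mult_le_mono2)
    also have "\<dots> \<le> 2 * (p * D) + c * (x + y)"
      using upper[of x] upper[of y] by (simp add: algebra_simps)
    finally have "p * r_max k N + c * w \<le> 2 * (p * D) + c * N"
      by (simp add: Ny algebra_simps)
    moreover have "p * r_max k N = p * r_max k n + c * (p * (L + w))"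
      unfolding N_def mult by (simp add: algebra_simps)
    moreover have "c * N = c * n + c * (p * (L + w))"
      by (simp add: N_def algebra_simps)
    moreover have "w \<le> c * w"
      using c by simp
    ultimately show False
      using w_def by linarith
  qed
  then show False
    using L A(2) by blast
qed

subsection \<open>Decomposition into geometric chains\<close>

lemma ex_power_decomp:
  fixes s a :: nat
  assumes "s \<ge> 2" "a \<ge> 1"
  shows "\<exists>u i. u \<ge> 1 \<and> \<not> s dvd u \<and> a = u * s ^ i"
  using \<open>a \<ge> 1\<close>
proof (induction a rule: less_induct)
  case (less a)
  show ?case
  proof (cases "s dvd a")
    case False
    then show ?thesis
      using less.prems by (intro exI[of _ a] exI[of _ 0]) auto
  next
    case True
    then obtain b where b: "a = s * b"
      by blast
    then have "b \<ge> 1"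
      using less.prems by (cases b) auto
    then have "b < a"
      using b assms(1) by simp
    then obtain u i where "u \<ge> 1" "\<not> s dvd u" "b = u * s ^ i"
      using less.IH \<open>b \<ge> 1\<close> by blast
    then show ?thesis
      using b by (intro exI[of _ u] exI[of _ "Suc i"]) auto
  qed
qed

text \<open>If the exponents differed, cancelling the smaller power of \<open>s\<close> would make
  the cofactor it belonged to divisible by \<open>s\<close>.\<close>

lemma power_decomp_unique:
  fixes s u v :: nat
  assumes "s \<ge> 2" "\<not> s dvd u" "\<not> s dvd v" "u * s ^ i = v * s ^ j"
  shows "u = v \<and> i = j"
proof -
  have *: "i = j" if "\<not> s dvd u" "u * s ^ i = v * s ^ j" "i \<le> j" for u v i j
  proof (rule ccontr)
    assume "i \<noteq> j"
    then obtain t where t: "j = i + Suc t"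
      using \<open>i \<le> j\<close> by (metis add_Suc_right le_neq_implies_less less_imp_Suc_add)
    have "u * s ^ i = (v * s ^ t * s) * s ^ i"
      using that(2) t by (simp add: power_add algebra_simps)
    then have "u = v * s ^ t * s"
      using assms(1) by simp
    then show False
      using that(1) by simp
  qed
  have "i = j"
    using *[of u i v j] *[of v j u i] assms by (cases "i \<le> j") auto
  then show ?thesis
    using assms by simp
qed

text \<open>For \<open>s \<ge> 2\<close> and \<open>u \<ge> 1\<close> this is the number of chain
  elements \<open>u * s ^ i\<close> up to \<open>n\<close>, since exponents start at 0.\<close>

definition chain_length :: "nat \<Rightarrow> nat \<Rightarrow> nat \<Rightarrow> nat" where
  "chain_length s n u = (LEAST i. n < u * s ^ i)"

lemma less_chain_length_iff:
  assumes "s \<ge> 2" "u \<ge> 1"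
  shows "i < chain_length s n u \<longleftrightarrow> u * s ^ i \<le> n"
proof
  show "u * s ^ i \<le> n" if "i < chain_length s n u"
    using not_less_Least[OF that[unfolded chain_length_def]] by simp
  have "n < s ^ n"
    using assms(1) by (intro power_gt_expt) auto
  also have "s ^ n \<le> u * s ^ n"
    using assms(2) by simp
  finally have *: "n < u * s ^ chain_length s n u"
    unfolding chain_length_def by (rule LeastI)
  show "i < chain_length s n u" if "u * s ^ i \<le> n"
  proof (rule ccontr)
    assume "\<not> ?thesis"
    then have "u * s ^ chain_length s n u \<le> u * s ^ i"
      using assms by (intro mult_left_mono power_increasing) auto
    then show False
      using * that by linarith
  qed
qed

lemma finite_gp_free: "finite {A. A \<subseteq> {1..n} \<and> gp_free k s A}"
  by (rule finite_subset[of _ "Pow {1..n}"]) auto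

text \<open>A progression whose ratio is a power of \<open>s\<close> never leaves its chain, so the
  chains impose independent conditions on their exponents. Restricting to chains gives the upper
  bound, and gluing extremal exponent sets attains it.\<close>

lemma g_max_eq_sum_chains:
  assumes k: "k \<ge> 1" and s: "s \<ge> 2"
  shows "g_max k s n = (\<Sum>u | u \<in> {1..n} \<and> \<not> s dvd u. r_max k (chain_length s n u))"
proof -
  define U where "U = {u. u \<in> {1..n} \<and> \<not> s dvd u}"
  let ?R = "\<Sum>u\<in>U. r_max k (chain_length s n u)"
  have finU: "finite U"
    by (simp add: U_def)
  have U: "u \<ge> 1" "\<not> s dvd u" if "u \<in> U" for u
    using that by (auto simp: U_def)
  have card_chains: "card {u * s ^ i | u i. u \<in> U \<and> i \<in> B u} = (\<Sum>u\<in>U. card (B u))"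
    if "\<And>u. u \<in> U \<Longrightarrow> finite (B u)" for B
  proof -
    have "{u * s ^ i | u i. u \<in> U \<and> i \<in> B u} = (\<lambda>(u, i). u * s ^ i) ` (SIGMA u:U. B u)"
      by auto
    moreover have "inj_on (\<lambda>(u, i). u * s ^ i) (SIGMA u:U. B u)"
    proof (rule inj_onI)
      fix x y
      assume "x \<in> (SIGMA u:U. B u)" "y \<in> (SIGMA u:U. B u)"
        "(case x of (u, i) \<Rightarrow> u * s ^ i) = (case y of (u, i) \<Rightarrow> u * s ^ i)"
      then show "x = y"
        using power_decomp_unique[OF s U(2) U(2), of "fst x" "fst y" "snd x" "snd y"]
        by (auto simp: split_def prod_eq_iff)
    qed
    ultimately show ?thesis
      using finU that by (simp add: card_image)
  qed
  have "card A \<le> ?R" if A: "A \<subseteq> {1..n}" "gp_free k s A" for A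
  proof -
    define B where "B u = {i. u * s ^ i \<in> A}" for u
    have B: "B u \<subseteq> {0..<chain_length s n u}" if "u \<in> U" for u
      using A(1) less_chain_length_iff[OF s U(1)[OF that]] by (auto simp: B_def)
    have apB: "ap_free k (B u)" if u: "u \<in> U" for u
      unfolding ap_free_def
    proof safe
      fix v d :: nat
      assume d: "d \<ge> 1" and sub: "arith_prog k v d \<subseteq> B u"
      have "u * s ^ v * (s ^ d) ^ j \<in> A" if "j < k" for j
      proof -
        have "v + d * j \<in> B u"
          using sub that by (auto simp: arith_prog_def)
        then show ?thesis
          by (simp add: B_def power_add power_mult mult.assoc)
      qed
      then have "geom_prog k s (u * s ^ v) d \<subseteq> A"
        by (auto simp: geom_prog_def)
      moreover have "u * s ^ v \<ge> 1"
        using U(1)[OF u] s by simp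
      ultimately show False
        using A(2) d by (auto simp: gp_free_def)
    qed
    have "A \<subseteq> {u * s ^ i | u i. u \<in> U \<and> i \<in> B u}"
    proof
      fix a
      assume a: "a \<in> A"
      then have a1: "a \<ge> 1" "a \<le> n"
        using A(1) by auto
      obtain u i where ui: "u \<ge> 1" "\<not> s dvd u" "a = u * s ^ i"
        using ex_power_decomp[OF s a1(1)] by blast
      have "u \<le> a"
        using s ui(3) by simp
      then have "u \<in> U"
        using ui(1,2) a1(2) by (simp add: U_def)
      then show "a \<in> {u * s ^ i | u i. u \<in> U \<and> i \<in> B u}"
        using ui a by (auto simp: B_def)
    qed
    moreover have "{u * s ^ i | u i. u \<in> U \<and> i \<in> B u} \<subseteq> A"
      by (auto simp: B_def)
    ultimately have A_eq: "A = {u * s ^ i | u i. u \<in> U \<and> i \<in> B u}"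
      by (rule subset_antisym)
    have "card A = (\<Sum>u\<in>U. card (B u))"
      by (subst A_eq, rule card_chains) (rule finite_subset[OF B], auto)
    also have "\<dots> \<le> ?R"
      by (intro sum_mono card_le_r_max B apB)
    finally show ?thesis .
  qed
  moreover have "?R \<in> card ` {A. A \<subseteq> {1..n} \<and> gp_free k s A}"
  proof -
    have "\<forall>l. \<exists>A. A \<subseteq> {0..<l} \<and> ap_free k A \<and> card A = r_max k l"
      using r_max_attained[OF k] by metis
    then obtain E where E: "\<And>l. E l \<subseteq> {0..<l}" "\<And>l. ap_free k (E l)" "\<And>l. card (E l) = r_max k l"
      by metis
    define B where "B u = E (chain_length s n u)" for u
    define A where "A = {u * s ^ i | u i. u \<in> U \<and> i \<in> B u}"
    have "A \<subseteq> {1..n}"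
    proof
      fix a
      assume "a \<in> A"
      then obtain u i where ui: "a = u * s ^ i" "u \<in> U" "i \<in> B u"
        by (auto simp: A_def)
      then have "i < chain_length s n u"
        using E(1) by (force simp: B_def)
      then show "a \<in> {1..n}"
        using less_chain_length_iff[OF s U(1)] ui s U(1)[OF ui(2)] by simp
    qed
    moreover have "gp_free k s A"
      unfolding gp_free_def
    proof safe
      fix a d :: nat
      assume a: "a \<ge> 1" and d: "d \<ge> 1" and sub: "geom_prog k s a d \<subseteq> A"
      have mem: "a * (s ^ d) ^ j \<in> A" if "j < k" for j
        using sub that by (auto simp: geom_prog_def)
      have "a \<in> A"
        using mem[of 0] k by simp
      then obtain u v where u: "a = u * s ^ v" "u \<in> U"
        by (auto simp: A_def)
      \<comment> \<open>Uniqueness of the decomposition forces every term into the chain of the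
        first one, with exponent \<open>v + d * j\<close>.\<close>
      have "v + d * j \<in> B u" if j: "j < k" for j
      proof -
        obtain u' i where u': "a * (s ^ d) ^ j = u' * s ^ i" "u' \<in> U" "i \<in> B u'"
          using mem[OF j] by (auto simp: A_def)
        have "u * s ^ (v + d * j) = u' * s ^ i"
          using u(1) u'(1) by (simp add: power_add power_mult mult.assoc)
        then show ?thesis
          using power_decomp_unique[OF s U(2)[OF u(2)] U(2)[OF u'(2)]] u'(3) by metis
      qed
      then have "arith_prog k v d \<subseteq> B u"
        by (auto simp: arith_prog_def)
      then show False
        using E(2) d by (auto simp: B_def ap_free_def)
    qed
    moreover have "card A = ?R"
    proof -
      have "finite (B u)" for u
        unfolding B_def by (rule finite_subset[OF E(1)]) simp
      then show ?thesis
        using card_chains[of B] by (simp add: A_def B_def E(3))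
    qed
    ultimately show ?thesis
      by (intro image_eqI[of _ _ A]) simp_all
  qed
  ultimately have "g_max k s n = ?R"
    unfolding g_max_def using finite_gp_free by (intro Max_eqI) auto
  then show ?thesis
    by (simp add: U_def)
qed

text \<open>For \<open>k \<ge> 1\<close> monotonicity of \<open>r_max k\<close> makes the truncated
  subtraction exact. These increments become the base \<open>s\<close> digits of the limit divided
  by \<open>s - 1\<close>.\<close>

definition r_step :: "nat \<Rightarrow> nat \<Rightarrow> nat" where
  "r_step k i = r_max k (Suc i) - r_max k i"

lemma r_max_Suc: "k \<ge> 1 \<Longrightarrow> r_max k (Suc i) = r_max k i + r_step k i"
  using r_max_mono[of k i "Suc i"] by (simp add: r_step_def)

lemma r_step_le_1: "k \<ge> 1 \<Longrightarrow> r_step k i \<le> 1"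
  using r_max_Suc_le[of k i] by (simp add: r_step_def)

lemma r_max_eq_sum_r_step:
  assumes "k \<ge> 1"
  shows "r_max k l = (\<Sum>i<l. r_step k i)"
  using assms by (induction l) (simp_all add: r_max_0 r_max_Suc)

lemma card_non_multiples:
  fixes s m :: nat
  assumes "s \<ge> 1"
  shows "card {u \<in> {1..m}. \<not> s dvd u} = m - m div s"
proof -
  have "{u \<in> {1..m}. s dvd u} = (*) s ` {1..m div s}"
    using assms by (auto simp: less_eq_div_iff_mult_less_eq mult.commute image_iff elim!: dvdE)
  then have "card {u \<in> {1..m}. s dvd u} = m div s"
    using assms by (simp add: card_image inj_on_def)
  moreover have "{u \<in> {1..m}. \<not> s dvd u} = {1..m} - {u \<in> {1..m}. s dvd u}"
    by auto
  moreover have "card ({1..m} - {u \<in> {1..m}. s dvd u}) = card {1..m} - card {u \<in> {1..m}. s dvd u}"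
    by (intro card_Diff_subset) auto
  ultimately show ?thesis
    by simp
qed

text \<open>Double counting: the chain of \<open>u\<close> collects increment \<open>i\<close>
  exactly when \<open>u * s ^ i \<le> n\<close>, that is, when \<open>u \<le> n div s ^ i\<close>;
  such \<open>u\<close> are counted without the multiples of \<open>s\<close>. The range
  \<open>i < n\<close> suffices because \<open>i < s ^ i\<close>.\<close>

lemma g_max_eq_sum_r_step:
  assumes k: "k \<ge> 1" and s: "s \<ge> 2"
  shows "g_max k s n = (\<Sum>i<n. r_step k i * (n div s ^ i - n div s ^ Suc i))"
proof -
  define U where "U = {u. u \<in> {1..n} \<and> \<not> s dvd u}"
  have "r_max k (chain_length s n u) = (\<Sum>i<n. if u * s ^ i \<le> n then r_step k i else 0)"
    if "u \<in> U" for u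
  proof -
    have u: "u \<ge> 1"
      using that by (simp add: U_def)
    have "i < n" if "u * s ^ i \<le> n" for i
    proof -
      have "i < s ^ i"
        using s by (intro power_gt_expt) auto
      also have "\<dots> \<le> u * s ^ i"
        using u by simp
      finally show ?thesis
        using that by linarith
    qed
    then have "{..<chain_length s n u} = {i \<in> {..<n}. u * s ^ i \<le> n}"
      using less_chain_length_iff[OF s u] by auto
    then show ?thesis
      by (simp only: r_max_eq_sum_r_step[OF k] sum.inter_filter[OF finite_lessThan])
  qed
  then have "g_max k s n = (\<Sum>u\<in>U. \<Sum>i<n. if u * s ^ i \<le> n then r_step k i else 0)"
    using g_max_eq_sum_chains[OF k s] by (simp add: U_def)
  also have "\<dots> = (\<Sum>i<n. \<Sum>u\<in>U. if u * s ^ i \<le> n then r_step k i else 0)"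
    by (rule sum.swap)
  also have "\<dots> = (\<Sum>i<n. r_step k i * (n div s ^ i - n div s ^ Suc i))"
  proof (rule sum.cong)
    fix i
    have "s ^ i > 0"
      using s by simp
    have le: "u * s ^ i \<le> n \<longleftrightarrow> u \<le> n div s ^ i" for u
      using \<open>s ^ i > 0\<close> by (simp add: less_eq_div_iff_mult_less_eq)
    have "n div s ^ i \<le> n"
      by simp
    then have "{u \<in> U. u * s ^ i \<le> n} = {u \<in> {1..n div s ^ i}. \<not> s dvd u}"
      unfolding le by (auto simp: U_def intro: le_trans)
    then have "card {u \<in> U. u * s ^ i \<le> n} = n div s ^ i - n div s ^ Suc i"
      using card_non_multiples[of s "n div s ^ i"] s by (simp add: div_mult2_eq[of n "s ^ i" s] power_Suc2 del: power_Suc)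
    then show "(\<Sum>u\<in>U. if u * s ^ i \<le> n then r_step k i else 0) =
        r_step k i * (n div s ^ i - n div s ^ Suc i)"
      by (simp add: sum.inter_filter[symmetric] U_def)
  qed simp
  finally show ?thesis .
qed

section \<open>Passage to the density by dominated convergence\<close>

lemma tendsto_div_over_self:
  fixes q :: nat
  assumes "q \<ge> 1"
  shows "(\<lambda>n. real (n div q) / real n) \<longlonglongrightarrow> 1 / real q"
proof (rule LIM_zero_cancel, rule Lim_null_comparison)
  show "\<forall>\<^sub>F n in sequentially. norm (real (n div q) / real n - 1 / real q) \<le> 1 / real n"
  proof (rule eventually_sequentiallyI)
    fix n :: nat
    assume n: "1 \<le> n"
    have "real n = real q * real (n div q) + real (n mod q)"
      by (metis mult_div_mod_eq of_nat_add of_nat_mult)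
    then have "real (n div q) / real n - 1 / real q = - (real (n mod q) / (real n * real q))"
      using n assms by (simp add: field_simps)
    moreover have "real (n mod q) / (real n * real q) \<le> real q / (real n * real q)"
      using assms by (intro divide_right_mono) (auto simp: less_imp_le)
    ultimately show "norm (real (n div q) / real n - 1 / real q) \<le> 1 / real n"
      using assms by simp
  qed
qed (rule lim_1_over_n)

lemma summable_r_step:
  assumes "k \<ge> 1" "s \<ge> 2"
  shows "summable (\<lambda>i. real (r_step k i) * (1 / real s) ^ Suc i)"
proof (rule summable_comparison_test')
  show "summable (\<lambda>i. (1 / real s) ^ i)"
    using assms(2) by (intro summable_geometric) simp
  show "norm (real (r_step k i) * (1 / real s) ^ Suc i) \<le> (1 / real s) ^ i" for i
  proof -
    have "real (r_step k i) * (1 / real s) ^ Suc i \<le> 1 * (1 / real s) ^ i"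
      using r_step_le_1[OF assms(1), of i] assms(2)
      by (intro mult_mono power_decreasing) auto
    then show ?thesis
      by simp
  qed
qed

lemma g_max_density:
  assumes k: "k \<ge> 1" and s: "s \<ge> 2"
  shows "(\<lambda>n. real (g_max k s n) / real n)
    \<longlonglongrightarrow> (real s - 1) * (\<Sum>i. real (r_step k i) * (1 / real s) ^ Suc i)"
proof -
  define a where "a i n = real (r_step k i) * (real (n div s ^ i) / real n - real (n div s ^ Suc i) / real n)"
    for i n
  define b where "b i = real (r_step k i) * (1 / real (s ^ i) - 1 / real (s ^ Suc i))" for i
  have div_le: "n div s ^ Suc i \<le> n div s ^ i" for n i
    using s by (intro div_le_mono2 power_increasing) auto
  have lim: "(\<lambda>n. a i n) \<longlonglongrightarrow> b i" for i
    unfolding a_def b_def using s by (intro tendsto_intros tendsto_div_over_self) simp_all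
  have bound: "norm (a i n) \<le> (1 / real s) ^ i" for i n
  proof -
    have "real (n div s ^ i) / real n \<le> (1 / real s) ^ i"
    \<comment> \<open>The domination is shown for every \<open>n\<close>; at \<open>n = 0\<close>
      the quotient is \<open>0\<close> by the convention for division by zero.\<close>
    proof (cases "n = 0")
      case False
      have "real (n div s ^ i) \<le> real n / real (s ^ i)"
        by (rule of_nat_div_le_of_nat)
      then show ?thesis
        using False s by (simp add: field_simps)
    qed simp
    moreover have "real (n div s ^ Suc i) / real n \<ge> 0"
      by simp
    moreover have "real (n div s ^ Suc i) / real n \<le> real (n div s ^ i) / real n"
      using div_le by (intro divide_right_mono) (auto simp: of_nat_le_iff simp del: power_Suc)
    ultimately have "0 \<le> real (n div s ^ i) / real n - real (n div s ^ Suc i) / real n"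
        "real (n div s ^ i) / real n - real (n div s ^ Suc i) / real n \<le> (1 / real s) ^ i"
      by linarith+
    then have "0 \<le> a i n \<and> a i n \<le> 1 * (1 / real s) ^ i"
      unfolding a_def using r_step_le_1[OF k, of i]
      by (intro conjI mult_mono mult_nonneg_nonneg) simp_all
    then show ?thesis
      by simp
  qed
  have "summable (\<lambda>i. (1 / real s) ^ i)"
    using s by (intro summable_geometric) simp
  then have "(\<lambda>n. \<Sum>i. a i n) \<longlonglongrightarrow> suminf b"
    using tannerys_theorem[of a b sequentially "\<lambda>i. (1 / real s) ^ i", OF lim] bound
    by (simp add: eventually_True split_def)
  moreover have "(\<Sum>i. a i n) = real (g_max k s n) / real n" for n
  proof -
    have "a i n = 0" if "i \<notin> {..<n}" for i
    proof -
      have "n \<le> i"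
        using that by simp
      also have "i < s ^ i"
        using s by (intro power_gt_expt) auto
      finally have "n div s ^ i = 0"
        by simp
      then show ?thesis
        using div_le[of n i] by (simp add: a_def)
    qed
    then have "(\<Sum>i. a i n) = (\<Sum>i<n. a i n)"
      by (intro suminf_finite) auto
    also have "\<dots> = (\<Sum>i<n. real (r_step k i * (n div s ^ i - n div s ^ Suc i)) / real n)"
      using div_le by (intro sum.cong) (auto simp: a_def of_nat_diff diff_divide_distrib[symmetric] simp del: power_Suc)
    also have "\<dots> = real (g_max k s n) / real n"
      unfolding g_max_eq_sum_r_step[OF k s] by (simp add: sum_divide_distrib)
    finally show ?thesis .
  qed
  moreover have "suminf b = (real s - 1) * (\<Sum>i. real (r_step k i) * (1 / real s) ^ Suc i)"
  proof -
    \<comment> \<open>The factor \<open>s - 1\<close> comes from the difference of two consecutive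
      powers of \<open>1 / s\<close>.\<close>
    have "b = (\<lambda>i. (real s - 1) * (real (r_step k i) * (1 / real s) ^ Suc i))"
      using s by (simp add: b_def field_simps fun_eq_iff)
    then show ?thesis
      by (simp only: suminf_mult[OF summable_r_step[OF k s]])
  qed
  ultimately show ?thesis
    by simp
qed

subsection \<open>The series over fibres of \<open>r_max\<close>\<close>

text \<open>By monotonicity, a jump between \<open>i\<close> and \<open>Suc i\<close> makes
  \<open>Suc i\<close> the first length that attains the new value.\<close>

lemma min_fiber_term_r_max:
  assumes k: "k \<ge> 1" and i: "r_step k i = 1"
  shows "min_fiber_term k s (Suc (r_max k i)) = (1 / real s) ^ Suc i"
proof -
  have Suc_i: "Suc i \<in> r_inv k (Suc (r_max k i))"
    using r_max_Suc[OF k, of i] i by (simp add: r_inv_def)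
  moreover have "(LEAST l. l \<in> r_inv k (Suc (r_max k i))) = Suc i"
  proof (rule Least_equality)
    show "Suc i \<in> r_inv k (Suc (r_max k i))"
      by (rule Suc_i)
    show "Suc i \<le> l" if "l \<in> r_inv k (Suc (r_max k i))" for l
    proof (rule ccontr)
      assume "\<not> Suc i \<le> l"
      then have "r_max k l \<le> r_max k i"
        by (intro r_max_mono[OF k]) simp
      then show False
        using that by (simp add: r_inv_def)
    qed
  qed
  ultimately show ?thesis
    by (auto simp: min_fiber_term_def)
qed

lemma min_fiber_term_eq_0:
  assumes k: "k \<ge> 1" and m: "m \<notin> r_max k ` {i. r_step k i = 1}"
  shows "min_fiber_term k s (Suc m) = 0"
proof (rule ccontr)
  assume "\<not> ?thesis"
  then have ne: "r_inv k (Suc m) \<noteq> {}"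
    by (auto simp: min_fiber_term_def)
  define l where "l = (LEAST l. l \<in> r_inv k (Suc m))"
  have l: "l \<in> r_inv k (Suc m)"
    unfolding l_def using ne by (meson LeastI ex_in_conv)
  then obtain i where i: "l = Suc i"
    by (cases l) (auto simp: r_inv_def)
  have "i \<notin> r_inv k (Suc m)"
    using not_less_Least[of i "\<lambda>l. l \<in> r_inv k (Suc m)"] i by (simp add: l_def)
  \<comment> \<open>For \<open>i = 0\<close> the fibre excludes the length by definition, so
    \<open>r_max k 0 = 0\<close> is used instead.\<close>
  then have "r_max k i \<noteq> Suc m"
    using r_max_0[OF k] by (cases i) (auto simp: r_inv_def)
  moreover have "r_max k i + r_step k i = Suc m"
    using l i r_max_Suc[OF k, of i] by (simp add: r_inv_def)
  ultimately have "r_step k i = 1" "r_max k i = m"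
    using r_step_le_1[OF k, of i] by auto
  then show False
    using m by blast
qed

text \<open>\<open>r_max k\<close> maps the jump indices injectively to the values \<open>m\<close>
  that can contribute. The terms are nonnegative, so the series is an unordered sum, which may be
  reindexed and freed of zero terms.\<close>

lemma sums_min_fiber_term:
  assumes k: "k \<ge> 1" and s: "s \<ge> 2"
  shows "(\<lambda>m. min_fiber_term k s (Suc m)) sums (\<Sum>i. real (r_step k i) * (1 / real s) ^ Suc i)"
    (is "_ sums ?S")
proof -
  define I where "I = {i. r_step k i = 1}"
  have inj: "inj_on (r_max k) I"
  proof (rule linorder_inj_onI)
    fix i j
    assume "i < j" "i \<in> I" "j \<in> I"
    then have "r_max k i < r_max k (Suc i)" "r_max k (Suc i) \<le> r_max k j"
      using r_max_Suc[OF k, of i] r_max_mono[OF k, of "Suc i" j] by (auto simp: I_def)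
    then show "r_max k i \<noteq> r_max k j"
      by linarith
  qed auto
  have "((\<lambda>i. real (r_step k i) * (1 / real s) ^ Suc i) has_sum ?S) UNIV"
    using summable_sums[OF summable_r_step[OF k s]] by (rule sums_nonneg_imp_has_sum) simp
  also have "?this \<longleftrightarrow> (((\<lambda>m. min_fiber_term k s (Suc m)) \<circ> r_max k) has_sum ?S) I"
  proof (rule has_sum_cong_neutral)
    fix i
    show "real (r_step k i) * (1 / real s) ^ Suc i = 0" if "i \<in> UNIV - I"
      using that r_step_le_1[OF k, of i] by (simp add: I_def le_Suc_eq)
  qed (auto simp: I_def min_fiber_term_r_max[OF k])
  also have "\<dots> \<longleftrightarrow> ((\<lambda>m. min_fiber_term k s (Suc m)) has_sum ?S) (r_max k ` I)"
    by (rule has_sum_reindex[OF inj, symmetric])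
  also have "\<dots> \<longleftrightarrow> ((\<lambda>m. min_fiber_term k s (Suc m)) has_sum ?S) UNIV"
    using min_fiber_term_eq_0[OF k] by (intro has_sum_cong_neutral) (auto simp: I_def)
  finally show ?thesis
    by (rule has_sum_imp_sums)
qed

subsection \<open>Irrationality\<close>

text \<open>The shifted tails \<open>T n\<close> are multiples of \<open>1 / b\<close> in a bounded
  interval, so two of them coincide; a tail determines its first digit and the next tail.\<close>

lemma rational_digits_eventually_periodic:
  fixes e :: "nat \<Rightarrow> nat" and s :: nat
  assumes s: "s \<ge> 2" and e: "\<And>i. e i \<le> 1" and inf: "\<And>N. \<exists>i\<ge>N. e i = 1"
    and rat: "(\<Sum>i. real (e i) * (1 / real s) ^ Suc i) \<in> \<rat>"
  shows "\<exists>n p. p \<ge> 1 \<and> (\<forall>i\<ge>n. e (i + p) = e i)"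
proof -
  define T where "T n = (\<Sum>i. real (e (n + i)) * (1 / real s) ^ Suc i)" for n
  have geo: "summable (\<lambda>i. (1 / real s) ^ Suc i)"
    using s by (intro summable_Suc_iff[THEN iffD2] summable_geometric) simp
  have le: "real (e j) * (1 / real s) ^ Suc i \<le> (1 / real s) ^ Suc i" for i j
    using e[of j] by (intro mult_left_le_one_le) auto
  have summ: "summable (\<lambda>i. real (e (n + i)) * (1 / real s) ^ Suc i)" for n
    by (rule summable_comparison_test'[OF geo]) (use le in simp)
  have T_Suc: "T (Suc n) = real s * T n - real (e n)" for n
  proof -
    have "T n = real (e n) / real s + (\<Sum>i. real (e (n + Suc i)) * (1 / real s) ^ Suc (Suc i))"
      unfolding T_def using suminf_split_head[OF summ[of n]] by simp
    also have "(\<Sum>i. real (e (n + Suc i)) * (1 / real s) ^ Suc (Suc i)) =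
        (\<Sum>i. (1 / real s) * (real (e (Suc n + i)) * (1 / real s) ^ Suc i))"
      by (simp add: mult_ac)
    also have "\<dots> = (1 / real s) * T (Suc n)"
      unfolding T_def by (rule suminf_mult[OF summ])
    finally show ?thesis
      using s by (simp add: field_simps)
  qed
  have T_pos: "T n > 0" for n
  proof -
    obtain i where "i \<ge> n" "e i = 1"
      using inf by blast
    then have "real (e (n + (i - n))) * (1 / real s) ^ Suc (i - n) > 0"
      using s by simp
    then show ?thesis
      unfolding T_def by (intro suminf_pos2[OF summ]) auto
  qed
  have T_le: "T n \<le> 1" for n
  proof -
    have "T n \<le> (\<Sum>i. (1 / real s) ^ Suc i)"
      unfolding T_def using le by (intro suminf_le summ geo)
    also have "\<dots> = (1 / real s) * (1 / (1 - 1 / real s))"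
      using s suminf_mult[OF summable_geometric[of "1 / real s"], of "1 / real s"]
      by (simp add: suminf_geometric)
    also have "\<dots> \<le> 1"
      using s by (simp add: field_simps)
    finally show ?thesis .
  qed
  \<comment> \<open>\<open>s * T n\<close> lies in the half-open interval from \<open>e n\<close>,
    excluded, to \<open>e n + 1\<close>, included. Strict positivity of tails, from infinitely many
    digits 1, settles the ambiguity of binary expansions.\<close>
  have digit: "e n = 1 \<longleftrightarrow> real s * T n > 1" for n
    using T_Suc[of n] T_pos[of "Suc n"] T_le[of "Suc n"] e[of n] by (cases "e n") auto
  obtain a b :: int where ab: "b > 0" "T 0 = of_int a / of_int b"
    using rat by (auto simp: T_def elim!: Rats_cases')
  have int: "of_int b * T n \<in> \<int>" for n
  proof (induction n)
    case 0
    then show ?case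
      using ab by simp
  next
    case (Suc n)
    have "of_int b * T (Suc n) = real s * (of_int b * T n) - of_int b * real (e n)"
      by (simp add: T_Suc algebra_simps)
    also have "\<dots> \<in> \<int>"
      by (intro Ints_diff Ints_mult[OF _ Suc] Ints_mult) auto
    finally show ?case .
  qed
  \<comment> \<open>The floor only turns these integral reals into elements of type
    \<open>int\<close>, for the pigeonhole argument.\<close>
  have "\<lfloor>of_int b * T n\<rfloor> \<in> {0..b}" for n
  proof -
    have "of_int b * T n \<ge> 0" "of_int b * T n \<le> of_int b * 1"
      using ab(1) T_pos[of n] T_le[of n] by (auto intro: mult_left_mono simp: less_imp_le)
    then show ?thesis
      by (auto simp: floor_le_iff)
  qed
  then have "finite (range (\<lambda>n. \<lfloor>of_int b * T n\<rfloor>))"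
    by (intro finite_subset[OF image_subsetI finite_atLeastAtMost_int])
  then have "\<not> inj (\<lambda>n. \<lfloor>of_int b * T n\<rfloor>)"
    using finite_imageD[of _ "UNIV :: nat set"] by auto
  then obtain n m where nm: "n < m" "\<lfloor>of_int b * T n\<rfloor> = \<lfloor>of_int b * T m\<rfloor>"
    unfolding inj_def by (metis nat_neq_iff)
  have "of_int \<lfloor>of_int b * T j\<rfloor> = of_int b * T j" for j
    using int[of j] by (auto simp: Ints_def)
  then have "of_int b * T n = of_int b * T m"
    using nm(2) by metis
  then have Tnm: "T n = T m"
    using ab(1) by simp
  define p where "p = m - n"
  have "T (n + j + p) = T (n + j)" for j
  proof (induction j)
    case 0
    then show ?case
      using Tnm nm(1) by (simp add: p_def)
  next
    case (Suc j)
    have "e (n + j + p) = e (n + j)"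
      using digit[of "n + j + p"] digit[of "n + j"] Suc e[of "n + j + p"] e[of "n + j"]
      by (auto simp: le_Suc_eq)
    then show ?case
      using T_Suc[of "n + j + p"] T_Suc[of "n + j"] Suc by simp
  qed
  then have T_per: "T (i + p) = T i" if "i \<ge> n" for i
    using that by (metis le_add_diff_inverse)
  have "e (i + p) = e i" if "i \<ge> n" for i
    using T_per[OF that] digit[of "i + p"] digit[of i] e[of "i + p"] e[of i]
    by (auto simp: le_Suc_eq)
  moreover have "p \<ge> 1"
    using nm(1) by (simp add: p_def)
  ultimately show ?thesis
    by blast
qed

text \<open>Periodic increments add up to the recursion excluded by
  \<open>r_max_not_eventually_periodic\<close>. The bound \<open>k \<ge> 3\<close> gives
  unboundedness of \<open>r_max k\<close>, hence infinitely many nonzero digits.\<close>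

lemma r_step_series_irrational:
  assumes k: "k \<ge> 3" and s: "s \<ge> 2"
  shows "(\<Sum>i. real (r_step k i) * (1 / real s) ^ Suc i) \<notin> \<rat>"
proof
  assume rat: "(\<Sum>i. real (r_step k i) * (1 / real s) ^ Suc i) \<in> \<rat>"
  have k1: "k \<ge> 1"
    using k by simp
  have unbounded: "\<exists>m\<ge>l. r_max k m > c" for l c
  proof (intro exI conjI)
    have "2 ^ Suc c \<le> l + 2 ^ Suc c"
      by simp
    then show "c < r_max k (l + 2 ^ Suc c)"
      using r_max_unbounded[OF k, of "Suc c"] r_max_mono[OF k1] by (meson Suc_le_lessD le_trans)
  qed simp
  have inf: "\<exists>i\<ge>N. r_step k i = 1" for N
  proof (rule ccontr)
    assume "\<not> ?thesis"
    then have zero: "r_step k i = 0" if "i \<ge> N" for i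
      using that r_step_le_1[OF k1, of i] by (auto simp: le_Suc_eq)
    have "r_max k i = r_max k N" if "i \<ge> N" for i
      using that by (induction i rule: dec_induct) (simp_all add: r_max_Suc[OF k1] zero)
    then show False
      using unbounded[of N "r_max k N"] by (metis less_irrefl)
  qed
  obtain n p where p: "p \<ge> 1" and per: "\<And>i. i \<ge> n \<Longrightarrow> r_step k (i + p) = r_step k i"
    using rational_digits_eventually_periodic[OF s r_step_le_1[OF k1] inf rat] by blast
  define c where "c = r_max k (n + p) - r_max k n"
  have step: "r_max k (l + p) = r_max k l + c" if "l \<ge> n" for l
    using that
  proof (induction l rule: dec_induct)
    case base
    then show ?case
      using r_max_mono[OF k1, of n "n + p"] by (simp add: c_def)
  next
    case (step l)
    then show ?case
      using r_max_Suc[OF k1, of "l + p"] r_max_Suc[OF k1, of l] per[of l] by simp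
  qed
  obtain j where j: "j \<ge> n" "r_step k j = 1"
    using inf by blast
  \<comment> \<open>A nonzero digit beyond \<open>n\<close> falls within one period, so the growth
    \<open>c\<close> per period is positive.\<close>
  have "r_max k (Suc j) \<le> r_max k (j + p)"
    using p by (intro r_max_mono[OF k1]) simp
  then have "c \<ge> 1"
    using r_max_Suc[OF k1, of j] j step[of j] by simp
  then show False
    using r_max_not_eventually_periodic[OF k1 _ p step] by blast
qed

text \<open>For \<open>k = 2\<close> the only nonzero digit is the first, and the limit is the
  rational number \<open>(s - 1) / s\<close>; irrationality is therefore claimed from
  \<open>k = 3\<close> on.\<close>

theorem theorem1:
  fixes k s :: nat
  assumes "k \<ge> 2" and "s \<ge> 2"
  shows "summable (\<lambda>m. min_fiber_term k s (Suc m)) \<and>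
    (\<lambda>n. real (g_max k s n) / real n)
      \<longlonglongrightarrow> (real s - 1) * (\<Sum>m. min_fiber_term k s (Suc m)) \<and>
    (k \<ge> 3 \<longrightarrow> (real s - 1) * (\<Sum>m. min_fiber_term k s (Suc m)) \<notin> \<rat>)"
proof (intro conjI impI)
  have k: "k \<ge> 1"
    using assms(1) by simp
  note sums = sums_min_fiber_term[OF k assms(2)]
  show "summable (\<lambda>m. min_fiber_term k s (Suc m))"
    using sums by (rule sums_summable)
  show "(\<lambda>n. real (g_max k s n) / real n)
      \<longlonglongrightarrow> (real s - 1) * (\<Sum>m. min_fiber_term k s (Suc m))"
    using g_max_density[OF k assms(2)] sums_unique[OF sums] by simp
  show "(real s - 1) * (\<Sum>m. min_fiber_term k s (Suc m)) \<notin> \<rat>" if "k \<ge> 3"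
  proof
    assume "(real s - 1) * (\<Sum>m. min_fiber_term k s (Suc m)) \<in> \<rat>"
    moreover have "real s - 1 \<in> \<rat>"
      by simp
    ultimately have "(real s - 1) * (\<Sum>m. min_fiber_term k s (Suc m)) / (real s - 1) \<in> \<rat>"
      by (rule Rats_divide)
    then show False
      using r_step_series_irrational[OF that assms(2)] sums_unique[OF sums] assms(2) by simp
  qed
qed

end
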